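(* For any connected non-trivial graph $G$ of order $n\ge 2$ and any integer $n'\ge 2$, $$\dim_s(G\circ K_{n'})=n(n'-1)+\dim_s(G).$$
   Context: All graphs are simple and undirected. The order of a graph is its number of vertices; a graph is non-trivial if it has at least two vertices. $K_{n'}$ is the complete graph on $n'$ vertices. The lexicographic product $G\circ H$ has vertex set $V(G)\times V(H)$, and $(a,b),(c,d)$ are adjacent if and only if either $ac\in E(G)$, or ($a=c$ and $bd\in E(H)$). For a connected graph $F$, a vertex $w$ strongly resolves two vertices $u,v$ if $d_F(w,u)=d_F(w,v)+d_F(v,u)$ or $d_F(w,v)=d_F(w,u)+d_F(u,v)$. A set $S\subseteq V(F)$ is a strong metric generator for $F$ if every two distinct vertices of $F$ are strongly resolved by some vertex of $S$. The strong metric dimension $\dim_s(F)$ is the smallest cardinality of a strong metric generator for $F$. *)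

theory Defs
  imports Graph_Theory.Graph_Theory
begin

text \<open>
  Finite simple undirected graphs are the \<open>pair_graph\<close>s of the Graph Theory library: finite,
  loop-free, and with a symmetric set of arcs, an edge being the two arcs joining its end points.
\<close>

definition lex_product :: "'a pair_pre_digraph \<Rightarrow> 'b pair_pre_digraph \<Rightarrow> ('a \<times> 'b) pair_pre_digraph"
  where "lex_product G H =
    \<lparr> pverts = pverts G \<times> pverts H,
      parcs = {((a, b), (c, d)) | a b c d.
        a \<in> pverts G \<and> c \<in> pverts G \<and> b \<in> pverts H \<and> d \<in> pverts H \<and>
        ((a, c) \<in> parcs G \<or> a = c \<and> (b, d) \<in> parcs H)} \<rparr>"

text \<open>
  With unit weights the cost of a walk is its length. The distance is finite between any two
  vertices of a connected graph, the only case in which the notions below are used.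
\<close>

definition graph_dist :: "'a pair_pre_digraph \<Rightarrow> 'a \<Rightarrow> 'a \<Rightarrow> ereal"
  where "graph_dist F u v = wf_digraph.\<mu> (with_proj F) (\<lambda>_. 1) u v"

definition strongly_resolves :: "'a pair_pre_digraph \<Rightarrow> 'a \<Rightarrow> 'a \<Rightarrow> 'a \<Rightarrow> bool"
  where "strongly_resolves F w u v \<longleftrightarrow>
    graph_dist F w u = graph_dist F w v + graph_dist F v u \<or>
    graph_dist F w v = graph_dist F w u + graph_dist F u v"

definition strong_metric_generator :: "'a pair_pre_digraph \<Rightarrow> 'a set \<Rightarrow> bool"
  where "strong_metric_generator F S \<longleftrightarrow> S \<subseteq> pverts F \<and>
    (\<forall>u \<in> pverts F. \<forall>v \<in> pverts F. u \<noteq> v \<longrightarrow> (\<exists>w \<in> S. strongly_resolves F w u v))"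

definition strong_metric_dim :: "'a pair_pre_digraph \<Rightarrow> nat"
  where "strong_metric_dim F = (LEAST k. \<exists>S. strong_metric_generator F S \<and> card S = k)"

end

theory Submission
  imports Defs
begin

text \<open>
  Write \<open>V\<close>, \<open>W\<close> for the vertex sets of \<open>G\<close> and of the complete graph, and think of the product as one
  copy \<open>{a} \<times> W\<close> of the complete graph for every vertex \<open>a\<close> of \<open>G\<close>. Between different copies the
  distance is that of \<open>G\<close>; inside a copy all distances are 1. Two vertices of one copy therefore have
  the same distance to every third vertex and are strongly resolved by themselves only, so a
  generator \<open>S\<close> of the product leaves out at most one vertex of each copy. Let \<open>T\<close> be the set of those
  \<open>a\<close> whose copy lies inside \<open>S\<close>; then \<open>S\<close> has \<open>n (n' - 1) + |T|\<close> elements. The theorem follows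
  because \<open>S\<close> generates the product exactly when it leaves out at most one vertex of each copy and \<open>T\<close>
  generates \<open>G\<close> (lemma \<open>generator_lex_product_iff\<close>).

  That \<open>T\<close> must generate \<open>G\<close> is the less obvious direction. The vertices missing from the copies of
  \<open>p\<close> and \<open>q\<close>, both outside \<open>T\<close>, are strongly resolved by an element of \<open>S\<close>, and the distances force this
  element into the copy of a third vertex \<open>x\<close>, which then strongly resolves \<open>p\<close> and \<open>q\<close> in \<open>G\<close>. But \<open>x\<close>
  need not lie in \<open>T\<close>. Lemma \<open>generator_if_resolved_elsewhere\<close> removes this gap by
  maximality: \<open>x\<close> prolongs a geodesic through \<open>p\<close> and \<open>q\<close>, and a longest geodesic cannot be prolonged,
  so one of its ends lies in \<open>T\<close>.
\<close>

section \<open>Distances as least numbers of steps\<close>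

definition step_dist :: "'a rel \<Rightarrow> 'a \<Rightarrow> 'a \<Rightarrow> nat"
  where "step_dist R u v = (LEAST k. (u, v) \<in> R ^^ k)"

lemma relpow_step_dist: "(u, v) \<in> R\<^sup>* \<Longrightarrow> (u, v) \<in> R ^^ step_dist R u v"
  unfolding step_dist_def by (rule LeastI_ex) (simp add: rtrancl_power)

lemma step_dist_le: "(u, v) \<in> R ^^ k \<Longrightarrow> step_dist R u v \<le> k"
  unfolding step_dist_def by (rule Least_le)

lemma step_dist_self [simp]: "step_dist R u u = 0"
  using step_dist_le[of u u 0 R] by simp

lemma step_dist_pos: "(u, v) \<in> R\<^sup>* \<Longrightarrow> u \<noteq> v \<Longrightarrow> 0 < step_dist R u v"
  using relpow_step_dist[of u v R] by (cases "step_dist R u v") auto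

lemma step_dist_triangle:
  assumes "(u, v) \<in> R\<^sup>*" and "(v, w) \<in> R\<^sup>*"
  shows "step_dist R u w \<le> step_dist R u v + step_dist R v w"
proof (rule step_dist_le)
  show "(u, w) \<in> R ^^ (step_dist R u v + step_dist R v w)"
    unfolding relpow_add using assms[THEN relpow_step_dist] by blast
qed

lemma step_dist_commute: "sym R \<Longrightarrow> step_dist R u v = step_dist R v u"
proof -
  assume "sym R"
  have "(y, x) \<in> R ^^ k" if "(x, y) \<in> R ^^ k" for x y k
    using that
  proof (induction k arbitrary: y)
    case (Suc k)
    then show ?case using \<open>sym R\<close> by (meson relpow_Suc_E relpow_Suc_I2 symD)
  qed simp
  then have "(u, v) \<in> R ^^ k \<longleftrightarrow> (v, u) \<in> R ^^ k" for k
    by blast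
  then show ?thesis
    unfolding step_dist_def by simp
qed

lemma (in pair_wf_digraph) relpow_iff_awalk:
  assumes "u \<in> pverts G"
  shows "(u, v) \<in> parcs G ^^ k \<longleftrightarrow> (\<exists>p. awalk u p v \<and> length p = k)"
  using assms
proof (induction k arbitrary: u)
  case 0
  then show ?case by (auto simp: awalk_Nil_iff)
next
  case (Suc k)
  have "(u, v) \<in> parcs G ^^ Suc k \<longleftrightarrow> (\<exists>w. (u, w) \<in> parcs G \<and> (w, v) \<in> parcs G ^^ k)"
    by (metis relpow_Suc_I2 relpow_Suc_D2)
  also have "\<dots> \<longleftrightarrow> (\<exists>w. (u, w) \<in> parcs G \<and> (\<exists>p. awalk w p v \<and> length p = k))"
    using Suc.IH in_arcsD2 by blast
  also have "\<dots> \<longleftrightarrow> (\<exists>p. awalk u p v \<and> length p = Suc k)"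
  proof
    assume "\<exists>w. (u, w) \<in> parcs G \<and> (\<exists>p. awalk w p v \<and> length p = k)"
    then obtain w p where "(u, w) \<in> parcs G" "awalk w p v" "length p = k" by blast
    then have "awalk u ((u, w) # p) v \<and> length ((u, w) # p) = Suc k"
      by (simp add: awalk_Cons_iff)
    then show "\<exists>p. awalk u p v \<and> length p = Suc k" by blast
  next
    assume "\<exists>p. awalk u p v \<and> length p = Suc k"
    then obtain x w p where "awalk u ((x, w) # p) v" "length p = k"
      by (auto simp: length_Suc_conv)
    then show "\<exists>w. (u, w) \<in> parcs G \<and> (\<exists>p. awalk w p v \<and> length p = k)"
      by (auto simp: awalk_Cons_iff)
  qed
  finally show ?case .
qed

lemma graph_dist_eq_step_dist:
  assumes "pair_wf_digraph F" and "u \<in> pverts F" and "(u, v) \<in> (parcs F)\<^sup>*"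
  shows "graph_dist F u v = ereal (real (step_dist (parcs F) u v))"
proof -
  interpret pair_wf_digraph F by fact
  have cost: "awalk_cost (\<lambda>_. 1) p = real (length p)" for p :: "('a \<times> 'a) list"
    by (induction p) (auto simp: awalk_cost_def)
  obtain p where p: "awalk u p v" "length p = step_dist (parcs F) u v"
    using relpow_step_dist[OF assms(3)] relpow_iff_awalk[OF assms(2)] by blast
  have "\<mu> (\<lambda>_. 1) u v = ereal (real (step_dist (parcs F) u v))"
    unfolding \<mu>_def
  proof (rule INF_eqI)
    fix q assume "q \<in> {p. awalk u p v}"
    then have "(u, v) \<in> parcs F ^^ length q"
      using relpow_iff_awalk[OF assms(2)] by blast
    then show "ereal (real (step_dist (parcs F) u v)) \<le> ereal (awalk_cost (\<lambda>_. 1) q)"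
      by (simp add: cost step_dist_le)
  next
    fix y assume "\<And>q. q \<in> {p. awalk u p v} \<Longrightarrow> y \<le> ereal (awalk_cost (\<lambda>_. 1) q)"
    from this[of p] p show "y \<le> ereal (real (step_dist (parcs F) u v))"
      by (simp add: cost)
  qed
  then show ?thesis by (simp add: graph_dist_def)
qed

section \<open>Strong metric generators of a connected graph\<close>

lemma strongly_resolves_commute: "strongly_resolves F w u v \<longleftrightarrow> strongly_resolves F w v u"
  unfolding strongly_resolves_def by blast

locale connected_pair_graph = pair_graph +
  assumes connected: "Digraph_Component.connected (with_proj G)"
begin

abbreviation dist_nat :: "'a \<Rightarrow> 'a \<Rightarrow> nat"
  where "dist_nat \<equiv> step_dist (parcs G)"

lemma verts_reachable:
  assumes "u \<in> pverts G" "v \<in> pverts G"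
  shows "(u, v) \<in> (parcs G)\<^sup>*"
proof -
  have "u \<rightarrow>\<^sup>*\<^bsub>with_proj G\<^esub> v"
    using symmetric_connected_imp_strongly_connected[OF sym_arcs connected] assms
    by (simp add: strongly_connected_def)
  from reachable_rtranclI[OF this] show ?thesis by simp
qed

lemma graph_dist_eq:
  "u \<in> pverts G \<Longrightarrow> v \<in> pverts G \<Longrightarrow> graph_dist G u v = ereal (real (dist_nat u v))"
  by (rule graph_dist_eq_step_dist) (auto simp: verts_reachable)

lemma dist_nat_commute: "dist_nat u v = dist_nat v u"
  by (rule step_dist_commute) (auto intro: symI arcs_symmetric)

lemma dist_nat_triangle:
  "u \<in> pverts G \<Longrightarrow> v \<in> pverts G \<Longrightarrow> w \<in> pverts G \<Longrightarrow> dist_nat u w \<le> dist_nat u v + dist_nat v w"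
  by (intro step_dist_triangle verts_reachable)

lemma dist_nat_pos: "u \<in> pverts G \<Longrightarrow> v \<in> pverts G \<Longrightarrow> u \<noteq> v \<Longrightarrow> 0 < dist_nat u v"
  by (intro step_dist_pos verts_reachable)

lemma strongly_resolves_iff:
  assumes "w \<in> pverts G" "u \<in> pverts G" "v \<in> pverts G"
  shows "strongly_resolves G w u v \<longleftrightarrow>
    dist_nat w u = dist_nat w v + dist_nat v u \<or> dist_nat w v = dist_nat w u + dist_nat u v"
  using assms by (simp add: strongly_resolves_def graph_dist_eq flip: of_nat_add)

text \<open>
  The resolving vertices supplied by the hypothesis may lie outside \<open>T\<close>. Given \<open>a\<close> and \<open>c\<close>, take a
  longest geodesic that runs through \<open>a\<close> and then through \<open>c\<close>. If neither of its ends were in \<open>T\<close>, the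
  hypothesis would prolong it; so one end is in \<open>T\<close>, and this end strongly resolves \<open>a\<close> and \<open>c\<close>.
\<close>

lemma generator_if_resolved_elsewhere:
  assumes "T \<subseteq> pverts G"
    and elsewhere: "\<And>p q. p \<in> pverts G - T \<Longrightarrow> q \<in> pverts G - T \<Longrightarrow> p \<noteq> q \<Longrightarrow>
      \<exists>x \<in> pverts G - {p, q}. strongly_resolves G x p q"
  shows "strong_metric_generator G T"
  unfolding strong_metric_generator_def
proof (intro conjI ballI impI)
  fix a c assume V: "a \<in> pverts G" "c \<in> pverts G" and "a \<noteq> c"
  define P where "P = {(p, q) \<in> pverts G \<times> pverts G.
    dist_nat p q = dist_nat p a + dist_nat a c + dist_nat c q}"
  have "P \<subseteq> pverts G \<times> pverts G" unfolding P_def by auto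
  then have "finite P" by (rule finite_subset) simp
  moreover have "(a, c) \<in> P" using V unfolding P_def by simp
  ultimately obtain r where "r \<in> P" "(MAX (p, q) \<in> P. dist_nat p q) = (\<lambda>(p, q). dist_nat p q) r"
    using obtains_MAX[of P "\<lambda>(p, q). dist_nat p q"] by (metis empty_iff)
  with \<open>finite P\<close> obtain p q where "(p, q) \<in> P"
    and longest: "\<And>p' q'. (p', q') \<in> P \<Longrightarrow> dist_nat p' q' \<le> dist_nat p q"
    using Max_ge[of "(\<lambda>(p, q). dist_nat p q) ` P"] by (cases r) force
  then have pq: "p \<in> pverts G" "q \<in> pverts G"
    "dist_nat p q = dist_nat p a + dist_nat a c + dist_nat c q"
    unfolding P_def by auto
  have pc: "dist_nat p c = dist_nat p a + dist_nat a c"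
    using pq V dist_nat_triangle[of p a c] dist_nat_triangle[of p c q] by simp
  have aq: "dist_nat q a = dist_nat q c + dist_nat c a"
    using pq V dist_nat_triangle[of a c q] dist_nat_triangle[of p a q]
    by (simp add: dist_nat_commute)
  have "p \<noteq> q"
    using pq dist_nat_pos[OF V \<open>a \<noteq> c\<close>] by auto
  have "p \<in> T \<or> q \<in> T"
  proof (rule ccontr)
    assume "\<not> (p \<in> T \<or> q \<in> T)"
    then obtain x where x: "x \<in> pverts G" "x \<noteq> p" "x \<noteq> q" "strongly_resolves G x p q"
      using elsewhere[of p q] pq \<open>p \<noteq> q\<close> by blast
    note pos = dist_nat_pos[OF x(1) pq(1) x(2)] dist_nat_pos[OF x(1) pq(2) x(3)]
    consider "dist_nat x p = dist_nat x q + dist_nat q p" | "dist_nat x q = dist_nat x p + dist_nat p q"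
      using x pq by (auto simp: strongly_resolves_iff)
    then show False
    proof cases
      case 1
      then have px: "dist_nat p x = dist_nat p q + dist_nat q x"
        by (simp add: dist_nat_commute)
      have "dist_nat p x = dist_nat p a + dist_nat a c + dist_nat c x"
        using px pq pc V x dist_nat_triangle[of c q x] dist_nat_triangle[of p c x] by simp
      then have "(p, x) \<in> P" using x pq unfolding P_def by simp
      with longest[of p x] px pos show False by (simp add: dist_nat_commute)
    next
      case 2
      have "dist_nat x q = dist_nat x a + dist_nat a c + dist_nat c q"
        using 2 pq V x dist_nat_triangle[of x p a] dist_nat_triangle[of x a q]
          dist_nat_triangle[of a c q] by simp
      then have "(x, q) \<in> P" using x pq unfolding P_def by simp
      with longest[of x q] 2 pos show False by simp
    qed
  qed
  moreover have "strongly_resolves G p a c" "strongly_resolves G q a c"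
    using pq V pc aq by (simp_all add: strongly_resolves_iff)
  ultimately show "\<exists>w \<in> T. strongly_resolves G w a c"
    by blast
qed fact

lemma strongly_resolves_end:
  assumes "u \<in> pverts G" "v \<in> pverts G"
  shows "strongly_resolves G u u v"
  using assms by (simp add: strongly_resolves_iff)

lemma generator_pverts: "strong_metric_generator G (pverts G)"
  unfolding strong_metric_generator_def using strongly_resolves_end by blast

end

lemma strong_metric_dim_le: "strong_metric_generator F S \<Longrightarrow> strong_metric_dim F \<le> card S"
  unfolding strong_metric_dim_def by (rule Least_le) blast

lemma strong_metric_dim_attained:
  assumes "strong_metric_generator F S"
  obtains B where "strong_metric_generator F B" and "card B = strong_metric_dim F"
proof -
  have "\<exists>B. strong_metric_generator F B \<and> card B = strong_metric_dim F"
    unfolding strong_metric_dim_def by (rule LeastI_ex) (use assms in blast)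
  then show ?thesis using that by blast
qed

section \<open>Distances in the lexicographic product\<close>

lemma pverts_lex_product [simp]: "pverts (lex_product G H) = pverts G \<times> pverts H"
  by (simp add: lex_product_def)

lemma parcs_lex_product_iff:
  "((a, b), (c, d)) \<in> parcs (lex_product G H) \<longleftrightarrow>
    a \<in> pverts G \<and> c \<in> pverts G \<and> b \<in> pverts H \<and> d \<in> pverts H \<and>
    ((a, c) \<in> parcs G \<or> a = c \<and> (b, d) \<in> parcs H)"
  by (auto simp: lex_product_def)

lemma pair_wf_lex_product: "pair_wf_digraph (lex_product G H)"
  by unfold_locales (auto simp: lex_product_def)

lemma relpow_lex_product_project:
  "((a, b), (c, d)) \<in> parcs (lex_product G H) ^^ k \<Longrightarrow> \<exists>j \<le> k. (a, c) \<in> parcs G ^^ j"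
proof (induction k arbitrary: c d)
  case (Suc k)
  then obtain c' d' where step: "((a, b), (c', d')) \<in> parcs (lex_product G H) ^^ k"
    "((c', d'), (c, d)) \<in> parcs (lex_product G H)"
    by auto
  with Suc.IH obtain j where "j \<le> k" "(a, c') \<in> parcs G ^^ j" by blast
  with step(2) show ?case
    by (auto simp: parcs_lex_product_iff intro: le_SucI relpow_Suc_I exI[of _ j] exI[of _ "Suc j"])
qed auto

text \<open>
  At least one step is needed to move to an arbitrary second coordinate: the last step between two
  copies can end anywhere in the copy that it enters.
\<close>

lemma (in pair_wf_digraph) relpow_lex_product_lift:
  assumes "b \<in> pverts H"
  shows "(a, c) \<in> parcs G ^^ Suc k \<Longrightarrow> d \<in> pverts H \<Longrightarrow>
    ((a, b), (c, d)) \<in> parcs (lex_product G H) ^^ Suc k"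
proof (induction k arbitrary: c d)
  case 0
  then show ?case using assms by (auto simp: parcs_lex_product_iff dest: in_arcsD1 in_arcsD2)
next
  case (Suc k)
  from Suc.prems(1) obtain c' where "(a, c') \<in> parcs G ^^ Suc k" "(c', c) \<in> parcs G"
    by (rule relpow_Suc_E)
  then have "((c', b), (c, d)) \<in> parcs (lex_product G H)"
    using Suc.prems(2) assms by (auto simp: parcs_lex_product_iff dest: in_arcsD1 in_arcsD2)
  with Suc.IH[OF \<open>(a, c') \<in> parcs G ^^ Suc k\<close> assms] show ?case
    by (rule relpow_Suc_I)
qed

context connected_pair_graph
begin

lemma graph_dist_lex_product_across:
  assumes "a \<in> pverts G" "c \<in> pverts G" "b \<in> pverts H" "d \<in> pverts H" and "a \<noteq> c"
  shows "graph_dist (lex_product G H) (a, b) (c, d) = graph_dist G a c"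
proof -
  let ?F = "lex_product G H"
  have pos: "dist_nat a c > 0" using assms dist_nat_pos by blast
  have ac: "(a, c) \<in> parcs G ^^ dist_nat a c"
    using assms by (intro relpow_step_dist verts_reachable)
  have lift: "((a, b), (c, d)) \<in> parcs ?F ^^ dist_nat a c"
    using relpow_lex_product_lift[of b H a c "dist_nat a c - 1" d] ac pos assms by simp
  then have reach: "((a, b), (c, d)) \<in> (parcs ?F)\<^sup>*"
    by (rule relpow_imp_rtrancl)
  obtain j where "j \<le> step_dist (parcs ?F) (a, b) (c, d)" "(a, c) \<in> parcs G ^^ j"
    using relpow_lex_product_project[OF relpow_step_dist[OF reach]] by blast
  then have "step_dist (parcs ?F) (a, b) (c, d) = dist_nat a c"
    using step_dist_le[of a c] step_dist_le[OF lift] by fastforce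
  then show ?thesis
    using graph_dist_eq_step_dist[OF pair_wf_lex_product _ reach] graph_dist_eq assms by simp
qed

end

lemma graph_dist_lex_product_self:
  "a \<in> pverts G \<Longrightarrow> b \<in> pverts H \<Longrightarrow> graph_dist (lex_product G H) (a, b) (a, b) = 0"
  by (subst graph_dist_eq_step_dist) (auto simp: pair_wf_lex_product)

lemma graph_dist_lex_product_within:
  assumes "a \<in> pverts G" "b \<in> pverts H" "d \<in> pverts H" "(b, d) \<in> parcs H" "b \<noteq> d"
  shows "graph_dist (lex_product G H) (a, b) (a, d) = 1"
proof -
  let ?R = "parcs (lex_product G H)"
  have arc: "((a, b), (a, d)) \<in> ?R" using assms by (simp add: parcs_lex_product_iff)
  then have "step_dist ?R (a, b) (a, d) = 1"
    using step_dist_le[of "(a, b)" "(a, d)" 1 ?R] step_dist_pos[of "(a, b)" "(a, d)" ?R] assms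
    by (simp add: r_into_rtrancl)
  then show ?thesis
    using arc assms by (subst graph_dist_eq_step_dist) (auto simp: pair_wf_lex_product)
qed

section \<open>Strong metric generators of the product with a complete graph\<close>

locale lex_product_complete = connected_pair_graph G for G :: "'a pair_pre_digraph" +
  fixes H :: "'b pair_pre_digraph"
  assumes finite_pverts_H: "finite (pverts H)" and pverts_H_nonempty: "pverts H \<noteq> {}"
    and parcs_H: "parcs H = {(b, d) \<in> pverts H \<times> pverts H. b \<noteq> d}"
begin

lemmas product_dists =
  graph_dist_lex_product_self graph_dist_lex_product_within graph_dist_lex_product_across

text \<open>
  Two vertices of one copy are equidistant from every third vertex, while their own distance is 1.
\<close>

lemma twins_resolved_by_ends:
  assumes "a \<in> pverts G" "b \<in> pverts H" "d \<in> pverts H" "b \<noteq> d" "w \<in> pverts G \<times> pverts H"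
    and "strongly_resolves (lex_product G H) w (a, b) (a, d)"
  shows "w = (a, b) \<or> w = (a, d)"
proof (rule ccontr)
  assume other: "\<not> ?thesis"
  obtain x y where w: "w = (x, y)" "x \<in> pverts G" "y \<in> pverts H" using assms by auto
  let ?r = "if x = a then 1 else graph_dist G x a"
  have "graph_dist (lex_product G H) w (a, e) = ?r" if "e \<in> {b, d}" for e
    using that w other assms by (auto simp: product_dists parcs_H)
  moreover have "?r \<noteq> ?r + 1"
    using w assms by (auto simp: graph_dist_eq one_ereal_def)
  ultimately show False
    using assms by (auto simp: strongly_resolves_def product_dists parcs_H)
qed

text \<open>
  Vertices in the copies of \<open>a\<close> and \<open>c\<close> are not resolved by a third vertex of one of these
  copies: that vertex is at distance 1 from one of them and is as far from the other as they
  are from each other, a positive distance.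
\<close>

lemma resolves_across_iff:
  assumes "a \<in> pverts G" "c \<in> pverts G" "a \<noteq> c" "b \<in> pverts H" "d \<in> pverts H"
    and "(x, y) \<in> pverts G \<times> pverts H" "(x, y) \<noteq> (a, b)" "(x, y) \<noteq> (c, d)"
  shows "strongly_resolves (lex_product G H) (x, y) (a, b) (c, d) \<longleftrightarrow>
    x \<notin> {a, c} \<and> strongly_resolves G x a c"
proof -
  have not_in_copy: "\<not> strongly_resolves (lex_product G H) (p, y) (p, e) (q, f)"
    if "p \<in> pverts G" "q \<in> pverts G" "p \<noteq> q" "e \<in> pverts H" "f \<in> pverts H" "y \<in> pverts H" "y \<noteq> e"
    for p q y e f
  proof -
    have "dist_nat p q > 0" using that dist_nat_pos by blast
    then show ?thesis
      using that dist_nat_commute[of q p]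
      by (auto simp: strongly_resolves_def product_dists parcs_H graph_dist_eq one_ereal_def)
  qed
  consider "x = a" | "x = c" | "x \<notin> {a, c}" by blast
  then show ?thesis
  proof cases
    case 1
    then show ?thesis using not_in_copy[of a c b d y] assms by auto
  next
    case 2
    then show ?thesis using not_in_copy[of c a d b y] assms
      by (subst strongly_resolves_commute) auto
  next
    case 3
    then show ?thesis using assms by (auto simp: strongly_resolves_def product_dists)
  qed
qed

lemma strongly_resolves_end_product:
  assumes "u \<in> pverts G \<times> pverts H"
  shows "strongly_resolves (lex_product G H) u u v"
  using assms by (cases u) (simp add: strongly_resolves_def graph_dist_lex_product_self)

text \<open>
  The set \<open>pverts G - fst ` (pverts G \<times> pverts H - S)\<close> consists of the vertices of \<open>G\<close> whose whole copy
  lies in \<open>S\<close>.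
\<close>

lemma generator_lex_product_iff:
  assumes "S \<subseteq> pverts G \<times> pverts H"
  shows "strong_metric_generator (lex_product G H) S \<longleftrightarrow>
    inj_on fst (pverts G \<times> pverts H - S) \<and>
    strong_metric_generator G (pverts G - fst ` (pverts G \<times> pverts H - S))"
    (is "?gen \<longleftrightarrow> inj_on fst ?M \<and> strong_metric_generator G ?T")
proof (intro iffI conjI)
  assume ?gen
  then have resolver: "\<exists>w \<in> S. strongly_resolves (lex_product G H) w u v"
    if "u \<in> pverts G \<times> pverts H" "v \<in> pverts G \<times> pverts H" "u \<noteq> v" for u v
    using that unfolding strong_metric_generator_def pverts_lex_product by blast
  show "inj_on fst ?M"
  proof (rule inj_onI, rule ccontr)
    fix u v assume uv: "u \<in> ?M" "v \<in> ?M" "fst u = fst v" "u \<noteq> v"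
    then obtain a b d where ab: "u = (a, b)" "v = (a, d)" by (metis prod.collapse)
    obtain w where "w \<in> S" "strongly_resolves (lex_product G H) w u v"
      using resolver[of u v] uv by auto
    then have "w = u \<or> w = v"
      using twins_resolved_by_ends[of a b d w] uv ab assms by auto
    with uv \<open>w \<in> S\<close> show False by auto
  qed
  show "strong_metric_generator G ?T"
  proof (rule generator_if_resolved_elsewhere)
    fix p q assume "p \<in> pverts G - ?T" "q \<in> pverts G - ?T" "p \<noteq> q"
    then obtain b d where M: "(p, b) \<in> ?M" "(q, d) \<in> ?M" by auto
    then obtain x y where w: "(x, y) \<in> S" "strongly_resolves (lex_product G H) (x, y) (p, b) (q, d)"
      using resolver[of "(p, b)" "(q, d)"] \<open>p \<noteq> q\<close> by fastforce
    moreover have "(x, y) \<noteq> (p, b)" "(x, y) \<noteq> (q, d)" using w(1) M by auto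
    ultimately have "x \<notin> {p, q} \<and> strongly_resolves G x p q"
      using resolves_across_iff[of p q b d x y] M \<open>p \<noteq> q\<close> assms by blast
    then show "\<exists>x \<in> pverts G - {p, q}. strongly_resolves G x p q"
      using w(1) assms by auto
  qed auto
next
  assume R: "inj_on fst ?M \<and> strong_metric_generator G ?T"
  show ?gen
    unfolding strong_metric_generator_def
  proof (intro conjI ballI impI)
    fix u v assume "u \<in> pverts (lex_product G H)" "v \<in> pverts (lex_product G H)" and "u \<noteq> v"
    then have uv: "u \<in> pverts G \<times> pverts H" "v \<in> pverts G \<times> pverts H" by simp_all
    show "\<exists>w \<in> S. strongly_resolves (lex_product G H) w u v"
    proof (cases "u \<in> S \<or> v \<in> S")
      case True
      then show ?thesis
        using uv strongly_resolves_end_product strongly_resolves_commute by metis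
    next
      case False
      obtain a b c d where eq: "u = (a, b)" "v = (c, d)" by (metis surj_pair)
      have M: "(a, b) \<in> ?M" "(c, d) \<in> ?M" using False uv eq by auto
      have "a \<noteq> c" using inj_onD[of fst ?M "(a, b)" "(c, d)"] R M \<open>u \<noteq> v\<close> eq by auto
      then obtain x where x: "x \<in> ?T" "strongly_resolves G x a c"
        using R M unfolding strong_metric_generator_def by blast
      have "x \<notin> {a, c}" using x(1) M[THEN imageI[of _ _ fst]] by auto
      obtain y where y: "y \<in> pverts H" using pverts_H_nonempty by blast
      have "(x, y) \<in> S" using x(1) y by force
      moreover have "strongly_resolves (lex_product G H) (x, y) u v"
        using resolves_across_iff[of a c b d x y] x y M \<open>a \<noteq> c\<close> \<open>x \<notin> {a, c}\<close> eq by auto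
      ultimately show ?thesis by blast
    qed
  qed (use assms in simp)
qed

lemma card_full_copies:
  assumes "S \<subseteq> pverts G \<times> pverts H" and "inj_on fst (pverts G \<times> pverts H - S)"
  shows "card S = card (pverts G) * (card (pverts H) - 1) +
    card (pverts G - fst ` (pverts G \<times> pverts H - S))"
proof -
  let ?M = "pverts G \<times> pverts H - S"
  have fin: "finite (pverts G \<times> pverts H)" using finite_pverts_H by simp
  have "card S + card ?M = card (pverts G) * card (pverts H)"
    using card_Diff_subset[OF finite_subset[OF assms(1) fin] assms(1)] card_mono[OF fin assms(1)]
    by (simp add: card_cartesian_product)
  moreover have "card (pverts G - fst ` ?M) + card ?M = card (pverts G)"
  proof -
    have sub: "fst ` ?M \<subseteq> pverts G" by auto
    have "card (fst ` ?M) = card ?M" using assms(2) by (rule card_image)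
    then show ?thesis
      using card_Diff_subset[OF finite_subset[OF sub finite_verts] sub] card_mono[OF finite_verts sub]
      by simp
  qed
  moreover have "card (pverts H) \<ge> 1"
    using finite_pverts_H pverts_H_nonempty by (simp add: Suc_le_eq card_gt_0_iff)
  then have "card (pverts G) * card (pverts H) = card (pverts G) * (card (pverts H) - 1) + card (pverts G)"
    by (cases "card (pverts H)") auto
  ultimately show ?thesis by linarith
qed

lemma strong_metric_dim_lex_product:
  "strong_metric_dim (lex_product G H) =
    card (pverts G) * (card (pverts H) - 1) + strong_metric_dim G"
proof (rule antisym)
  obtain T where T: "strong_metric_generator G T" "card T = strong_metric_dim G"
    using strong_metric_dim_attained[OF generator_pverts] .
  then have TV: "T \<subseteq> pverts G" by (simp add: strong_metric_generator_def)
  obtain h where h: "h \<in> pverts H" using pverts_H_nonempty by blast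
  \<comment> \<open>Leave out one and the same vertex \<open>h\<close> from every copy that is not over \<open>T\<close>.\<close>
  define S where "S = pverts G \<times> pverts H - (pverts G - T) \<times> {h}"
  have M: "pverts G \<times> pverts H - S = (pverts G - T) \<times> {h}"
    using h unfolding S_def by auto
  have full: "pverts G - fst ` (pverts G \<times> pverts H - S) = T"
    unfolding M using TV by force
  have S: "S \<subseteq> pverts G \<times> pverts H" "inj_on fst (pverts G \<times> pverts H - S)"
    unfolding M by (auto simp: S_def inj_on_def)
  then have "strong_metric_generator (lex_product G H) S"
    using generator_lex_product_iff[OF S(1)] T(1) full by simp
  then have "strong_metric_dim (lex_product G H) \<le> card S"
    by (rule strong_metric_dim_le)
  then show "strong_metric_dim (lex_product G H) \<le>
      card (pverts G) * (card (pverts H) - 1) + strong_metric_dim G"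
    using card_full_copies[OF S] full T(2) by simp
next
  have "strong_metric_generator (lex_product G H) (pverts G \<times> pverts H)"
    using generator_lex_product_iff[of "pverts G \<times> pverts H"] generator_pverts by simp
  then obtain S where S: "strong_metric_generator (lex_product G H) S"
    "card S = strong_metric_dim (lex_product G H)"
    by (rule strong_metric_dim_attained)
  then have sub: "S \<subseteq> pverts G \<times> pverts H" by (simp add: strong_metric_generator_def)
  show "card (pverts G) * (card (pverts H) - 1) + strong_metric_dim G \<le>
      strong_metric_dim (lex_product G H)"
    using generator_lex_product_iff[OF sub] card_full_copies[OF sub] S strong_metric_dim_le by force
qed

end

theorem theorem12:
  fixes G :: "'a pair_pre_digraph" and H :: "'b pair_pre_digraph" and n n' :: nat
  assumes "pair_graph G"
    and "Digraph_Component.connected (with_proj G)"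
    and "card (pverts G) = n" and "n \<ge> 2"
    and "n' \<ge> 2"
    and "complete_digraph n' (with_proj H)"
  shows "strong_metric_dim (lex_product G H) = n * (n' - 1) + strong_metric_dim G"
proof -
  have H: "finite (pverts H)" "card (pverts H) = n'"
    "parcs H = {(b, d) \<in> pverts H \<times> pverts H. b \<noteq> d}"
    using assms(6) unfolding complete_digraph_pair_def by auto
  interpret pair_graph G by fact
  interpret lex_product_complete G H
    using assms H by unfold_locales auto
  show ?thesis
    using strong_metric_dim_lex_product assms(3) H(2) by simp
qed

end
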